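(* Let $T\ge 1$ and fix either convention E ($\varepsilon=0$) or convention N ($\varepsilon=1$). Let $\mathcal R$ be the minimal-prefix rule $\mathcal O_{\min}$, or the maximal-prefix rule $\mathcal O_{\max}$, or any rule $\mathcal R_\eta$ of the form $\mathcal R_\eta(S,\preceq)=\mathcal O_{\min}(S,\preceq)$ if $\eta(S)=0$ and $\mathcal R_\eta(S,\preceq)=\mathcal O_{\max}(S,\preceq)$ if $\eta(S)=1$, where $\eta$ is a $\{0,1\}$-valued function of the sample $S$ alone. The rule $\mathcal R$ is announced before the learner and the instance are chosen. (a) For every deterministic learner $\mathcal A$ and every sequence of distinct instances $x_1,\dots,x_T$ there exist an admissible total order $\preceq^\star$ on $X$ and a point $z^\star\in X$ such that, when $\mathcal A$ is run with oracle $S\mapsto\mathcal R(S,\preceq^\star)$ and target $c_{z^\star}$, one has $M(\mathcal A)+Q(\mathcal A)\ge T-\varepsilon$. (b) Consequently $$\inf_{\mathcal A}\ \sup_{\preceq,\,z}\ (M+Q)=T-\varepsilon ,$$ where the infimum is over deterministic learners and the supremum over admissible orders $\preceq$ and targets $z\in X$, the oracle being $S\mapsto \mathcal R(S,\preceq)$. (The upper bound needs no calls: under E it is attained by any fixed prediction rule, under N by always predicting $1$.)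
   Context: Domain and conventions. $x_1,\dots,x_T$ are distinct instances, announced in advance in their order of arrival. Convention E: $X=\{s,x_1,\dots,x_T\}$ and only total orders on $X$ in which the sentinel $s$ is the minimum are admissible; put $\varepsilon=0$. Convention N: $X=\{x_1,\dots,x_T\}$, all total orders on $X$ are admissible; put $\varepsilon=1$. For a total order $\preceq$ on $X$ and $z\in X$ let $c_z(x)=\mathbf 1[x\preceq z]$ and $C_\preceq=\{c_z:z\in X\}$ (so concepts are indicators of nonempty prefixes of $X$). Oracle. A sample is a finite set $S\subseteq X\times\{0,1\}$; $c$ is consistent with $S$ if $c(x)=y$ for all $(x,y)\in S$. A selection rule $\mathcal R(S,\preceq)$ returns a concept of $C_\preceq$ consistent with $S$, given to the learner as a full label vector on $X$, or $\bot$ if no concept of $C_\preceq$ is consistent with $S$. $\mathcal O_{\min}(S,\preceq)$ returns the smallest consistent prefix (with respect to inclusion), $\mathcal O_{\max}(S,\preceq)$ the largest; both return $\bot$ if there is none. Protocol. The learner knows the convention, $X$, $T$, the sequence $x_1,\dots,x_T$ and the rule $\mathcal R$, but not $\preceq$ or $z$. In round $t=1,\dots,T$ it predicts $\hat y_t\in\{0,1\}$ and then sees $y_t=c_z(x_t)$. At any time it may call the oracle on any sample $S$, chosen adaptively (contradictory samples and samples involving any points of $X$ are allowed). A learner is deterministic if each action is a function of the history. $M$ is the number of rounds with $\hat y_t\ne y_t$; $Q$ is the total number of oracle calls (each call costs one). *)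

theory Defs
  imports Main "HOL-Library.Extended_Nat"
begin

datatype 'a convention = Conv_E (sentinel: 'a) | Conv_N

fun eps :: "'a convention \<Rightarrow> nat" where
  "eps (Conv_E s) = 0"
| "eps Conv_N = 1"

text \<open>The domain \<open>X\<close>; the list \<open>xs\<close> is the announced sequence of instances in order of arrival.\<close>

fun points :: "'a convention \<Rightarrow> 'a list \<Rightarrow> 'a set" where
  "points (Conv_E s) xs = insert s (set xs)"
| "points Conv_N xs = set xs"

fun valid_seq :: "'a convention \<Rightarrow> 'a list \<Rightarrow> bool" where
  "valid_seq (Conv_E s) xs \<longleftrightarrow> distinct xs \<and> s \<notin> set xs"
| "valid_seq Conv_N xs \<longleftrightarrow> distinct xs"

text \<open>A total order on \<open>X\<close> is a relation \<open>r\<close> whose pairs \<open>(x, y)\<close> mean that \<open>x\<close> is below or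
  equal to \<open>y\<close>. Since \<open>r\<close> is reflexive on \<open>X\<close> and contained in \<open>X \<times> X\<close>, its field is \<open>X\<close>.\<close>

definition admissible :: "'a convention \<Rightarrow> 'a list \<Rightarrow> 'a rel \<Rightarrow> bool" where
  "admissible conv xs r \<longleftrightarrow> linear_order_on (points conv xs) r \<and>
     (case conv of Conv_E s \<Rightarrow> \<forall>x \<in> points conv xs. (s, x) \<in> r | Conv_N \<Rightarrow> True)"

text \<open>The label 1 is \<^const>\<open>True\<close>. Concepts are total functions that are \<^const>\<open>False\<close> outside \<open>X\<close>,
  so the pointwise order on functions is inclusion of prefixes.\<close>

type_synonym 'a concept = "'a \<Rightarrow> bool"
type_synonym 'a sample = "('a \<times> bool) set"
type_synonym 'a rule = "'a sample \<Rightarrow> 'a rel \<Rightarrow> 'a concept option"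

definition concept :: "'a rel \<Rightarrow> 'a \<Rightarrow> 'a concept" where
  "concept r z = (\<lambda>x. (x, z) \<in> r)"

definition concepts :: "'a rel \<Rightarrow> 'a concept set" where
  "concepts r = concept r ` Field r"

definition consistent :: "'a concept \<Rightarrow> 'a sample \<Rightarrow> bool" where
  "consistent c S \<longleftrightarrow> (\<forall>(x, y) \<in> S. c x = y)"

text \<open>The value \<^const>\<open>None\<close> stands for \<open>\<bottom>\<close>.\<close>

definition O_min :: "'a rule" where
  "O_min S r = (if \<exists>c \<in> concepts r. consistent c S
     then Some (LEAST c. c \<in> concepts r \<and> consistent c S) else None)"

definition O_max :: "'a rule" where
  "O_max S r = (if \<exists>c \<in> concepts r. consistent c S
     then Some (GREATEST c. c \<in> concepts r \<and> consistent c S) else None)"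

definition R_eta :: "('a sample \<Rightarrow> bool) \<Rightarrow> 'a rule" where
  "R_eta \<eta> S r = (if \<eta> S then O_max S r else O_min S r)"

definition selection_rule :: "'a rule \<Rightarrow> bool" where
  "selection_rule R \<longleftrightarrow> R = O_min \<or> R = O_max \<or> (\<exists>\<eta>. R = R_eta \<eta>)"

text \<open>What the learner has seen and done so far, in chronological order: oracle calls with their
  answers, its own predictions, and the revealed labels.\<close>

datatype 'a event = Answer "'a sample" "'a concept option" | Prediction bool | Label bool

type_synonym 'a history = "'a event list"

definition predictions :: "'a history \<Rightarrow> bool list" where
  "predictions h = [b. Prediction b \<leftarrow> h]"

definition labels :: "'a history \<Rightarrow> bool list" where
  "labels h = [y. Label y \<leftarrow> h]"

definition mistakes :: "'a history \<Rightarrow> nat" where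
  "mistakes h = card {t. t < length (labels h) \<and> predictions h ! t \<noteq> labels h ! t}"

definition queries :: "'a history \<Rightarrow> nat" where
  "queries h = length [S. Answer S a \<leftarrow> h]"

text \<open>A deterministic learner sees the announced sequence and the history. At every point in time
  (before a prediction, between a prediction and the label, after the last label) \<open>ask\<close> is
  consulted first: \<^term>\<open>Some S\<close> calls the oracle on \<open>S\<close>, \<^const>\<open>None\<close> lets the protocol go on.\<close>

datatype 'a learner = Learner
  (ask: "'a list \<Rightarrow> 'a history \<Rightarrow> 'a sample option")
  (predict: "'a list \<Rightarrow> 'a history \<Rightarrow> bool")

definition learners :: "'a convention \<Rightarrow> 'a learner set" where
  "learners conv = {A. \<forall>xs h S. valid_seq conv xs \<longrightarrow> ask A xs h = Some S \<longrightarrow>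
     finite S \<and> S \<subseteq> points conv xs \<times> UNIV}"

text \<open>If there are more predictions than labels, the label of the current round is due. Rounds are
  numbered from 0, and a history with all labels is left unchanged once \<open>ask\<close> yields \<^const>\<open>None\<close>.\<close>

definition step :: "'a rule \<Rightarrow> 'a rel \<Rightarrow> 'a \<Rightarrow> 'a list \<Rightarrow> 'a learner \<Rightarrow> 'a history \<Rightarrow> 'a history" where
  "step R r z xs A h =
    (case ask A xs h of
      Some S \<Rightarrow> h @ [Answer S (R S r)]
    | None \<Rightarrow>
       (let t = length (labels h) in
        if t < length (predictions h) then h @ [Label (concept r z (xs ! t))]
        else if t < length xs then h @ [Prediction (predict A xs h)]
        else h))"

definition run :: "'a rule \<Rightarrow> 'a rel \<Rightarrow> 'a \<Rightarrow> 'a list \<Rightarrow> 'a learner \<Rightarrow> nat \<Rightarrow> 'a history" where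
  "run R r z xs A n = (step R r z xs A ^^ n) []"

text \<open>A learner that calls the oracle forever has \<open>Q = \<infinity>\<close>.\<close>

definition M :: "'a rule \<Rightarrow> 'a rel \<Rightarrow> 'a \<Rightarrow> 'a list \<Rightarrow> 'a learner \<Rightarrow> enat" where
  "M R r z xs A = (SUP n. enat (mistakes (run R r z xs A n)))"

definition Q :: "'a rule \<Rightarrow> 'a rel \<Rightarrow> 'a \<Rightarrow> 'a list \<Rightarrow> 'a learner \<Rightarrow> enat" where
  "Q R r z xs A = (SUP n. enat (queries (run R r z xs A n)))"

definition worst_case :: "'a convention \<Rightarrow> 'a rule \<Rightarrow> 'a list \<Rightarrow> 'a learner \<Rightarrow> enat" where
  "worst_case conv R xs A =
    (SUP (r, z) \<in> {r. admissible conv xs r} \<times> points conv xs. M R r z xs A + Q R r z xs A)"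

definition no_calls :: "('a list \<Rightarrow> 'a history \<Rightarrow> bool) \<Rightarrow> 'a learner" where
  "no_calls f = Learner (\<lambda>xs h. None) f"

end

theory Submission
  imports Defs
begin

text \<open>The adversary keeps an order of the form \<open>lo < U < hi\<close>, where \<open>lo\<close> and \<open>hi\<close> are committed lists
  labelled 1 and 0, and the points of the block \<open>U\<close> are still unordered. An oracle call is answered
  after moving at most one point of \<open>U\<close> to the end of \<open>lo\<close> or the front of \<open>hi\<close>, chosen such that
  the answer does not depend on the order inside the remaining block. A prediction on a point of \<open>U\<close>
  is made wrong by moving that point to the appropriate side. So \<open>U\<close> loses at most one point per
  call or mistake, while it must be empty at the end of the game.\<close>

section \<open>Linear orders given by lists, and their prefixes\<close>

primrec order_of :: "'a list \<Rightarrow> 'a rel" where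
  "order_of [] = {}"
| "order_of (w # ws) = {w} \<times> set (w # ws) \<union> order_of ws"

lemma order_of_append: "order_of (as @ bs) = order_of as \<union> set as \<times> set bs \<union> order_of bs"
  by (induction as) auto

lemma order_of_subset: "order_of ws \<subseteq> set ws \<times> set ws"
  by (induction ws) auto

lemma refl_order_of: "x \<in> set ws \<Longrightarrow> (x, x) \<in> order_of ws"
  by (induction ws) auto

lemma Field_order_of: "Field (order_of ws) = set ws"
  using order_of_subset[of ws] refl_order_of[of _ ws] by (auto simp: Field_def)

lemma linear_order_order_of:
  assumes "distinct ws"
  shows "linear_order_on (set ws) (order_of ws)"
proof -
  have "trans (order_of ws)"
    using assms
  proof (induction ws)
    case (Cons w ws)
    then have IH: "trans (order_of ws)" and w: "w \<notin> set ws"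
      by simp_all
    show ?case
    proof (rule transI)
      fix x y z
      assume "(x, y) \<in> order_of (w # ws)" "(y, z) \<in> order_of (w # ws)"
      then show "(x, z) \<in> order_of (w # ws)"
        using order_of_subset[of ws] transD[OF IH, of x y z] w by auto
    qed
  qed simp
  moreover have "antisym (order_of ws)"
    using assms
  proof (induction ws)
    case (Cons w ws)
    then show ?case
      using order_of_subset[of ws] by (auto simp: antisym_def)
  qed simp
  moreover have "total_on (set ws) (order_of ws)"
    by (induction ws) (auto simp: total_on_def)
  ultimately show ?thesis
    using order_of_subset[of ws] refl_order_of[of _ ws]
    by (auto simp: linear_order_on_def partial_order_on_def preorder_on_def refl_on_def)
qed

text \<open>The entry \<open>z\<close> occurs only once, so pairs ending in \<open>z\<close> come
  only from the entries before it and from \<open>z\<close> itself.\<close>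

lemma concept_order_of:
  assumes "distinct (as @ z # bs)"
  shows "concept (order_of (as @ z # bs)) z = (\<lambda>x. x \<in> set (as @ [z]))"
  using assms order_of_subset[of as] order_of_subset[of bs]
  by (auto simp: concept_def order_of_append fun_eq_iff)

text \<open>A concept cuts the list right after its threshold, so the prefix \<open>ps\<close>
  belongs to the threshold \<open>last ps\<close>.\<close>

lemma concepts_order_of:
  assumes "distinct ws"
  shows "concepts (order_of ws) = {\<lambda>x. x \<in> set ps | ps qs. ws = ps @ qs \<and> ps \<noteq> []}"
proof (intro set_eqI iffI)
  fix c assume "c \<in> concepts (order_of ws)"
  then obtain z where z: "z \<in> set ws" "c = concept (order_of ws) z"
    by (auto simp: concepts_def Field_order_of)
  then obtain as bs where "ws = as @ z # bs"
    by (meson split_list)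
  with z assms concept_order_of[of as z bs]
  have "c = (\<lambda>x. x \<in> set (as @ [z]))" "ws = (as @ [z]) @ bs"
    by simp_all
  then show "c \<in> {\<lambda>x. x \<in> set ps | ps qs. ws = ps @ qs \<and> ps \<noteq> []}"
    by blast
next
  fix c assume "c \<in> {\<lambda>x. x \<in> set ps | ps qs. ws = ps @ qs \<and> ps \<noteq> []}"
  then obtain ps qs where *: "c = (\<lambda>x. x \<in> set ps)" "ws = ps @ qs" "ps \<noteq> []"
    by blast
  then have ws: "ws = butlast ps @ last ps # qs"
    by simp
  then have "c = concept (order_of ws) (last ps)"
    using concept_order_of[of "butlast ps" "last ps" qs] assms *(1,3) by simp
  moreover have "last ps \<in> set ws"
    using *(2,3) by simp
  ultimately show "c \<in> concepts (order_of ws)"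
    by (simp add: concepts_def Field_order_of)
qed

section \<open>Oracle answers independent of the order inside the block\<close>

text \<open>A least consistent concept has a consistent member of \<open>F\<close> below it and
  hence equals it; a least consistent member of \<open>F\<close> is below every consistent concept.
  Thus the answer can be read off from \<open>F\<close> alone.\<close>

lemma O_min_eq_least_of_subset:
  assumes "F \<subseteq> concepts r"
    and "\<And>c. c \<in> concepts r \<Longrightarrow> consistent c S \<Longrightarrow> \<exists>f \<in> F. consistent f S \<and> f \<le> c"
  shows "O_min S r = (if \<exists>c \<in> F. consistent c S
    then Some (LEAST c. c \<in> F \<and> consistent c S) else None)"
proof -
  have "(\<exists>c \<in> concepts r. consistent c S) \<longleftrightarrow> (\<exists>c \<in> F. consistent c S)"
    using assms by blast
  moreover have "(LEAST c. c \<in> concepts r \<and> consistent c S) = (LEAST c. c \<in> F \<and> consistent c S)"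
    unfolding Least_def
  \<comment> \<open>The defining predicates agree, so the two values coincide whether or not a least
    element exists.\<close>
  proof (rule arg_cong[where f = The], rule ext)
    fix c
    show "((c \<in> concepts r \<and> consistent c S) \<and> (\<forall>y. y \<in> concepts r \<and> consistent y S \<longrightarrow> c \<le> y)) =
      ((c \<in> F \<and> consistent c S) \<and> (\<forall>y. y \<in> F \<and> consistent y S \<longrightarrow> c \<le> y))"
      (is "?C \<longleftrightarrow> ?F")
    proof
      assume c: ?C
      then obtain f where f: "f \<in> F" "consistent f S" "f \<le> c"
        using assms(2) by blast
      with c assms(1) have "f = c"
        by (intro antisym) auto
      with c f assms(1) show ?F by blast
    next
      assume c: ?F
      have "c \<le> y" if "y \<in> concepts r" "consistent y S" for y
        using assms(2)[OF that] c by (meson order_trans)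
      with c assms(1) show ?C by blast
    qed
  qed
  ultimately show ?thesis
    by (simp add: O_min_def)
qed

text \<open>Dual of \<open>O_min_eq_least_of_subset\<close>: \<open>F\<close> now has to dominate
  from above.\<close>

lemma O_max_eq_greatest_of_subset:
  assumes "F \<subseteq> concepts r"
    and "\<And>c. c \<in> concepts r \<Longrightarrow> consistent c S \<Longrightarrow> \<exists>f \<in> F. consistent f S \<and> c \<le> f"
  shows "O_max S r = (if \<exists>c \<in> F. consistent c S
    then Some (GREATEST c. c \<in> F \<and> consistent c S) else None)"
proof -
  have "(\<exists>c \<in> concepts r. consistent c S) \<longleftrightarrow> (\<exists>c \<in> F. consistent c S)"
    using assms by blast
  moreover have "(GREATEST c. c \<in> concepts r \<and> consistent c S) = (GREATEST c. c \<in> F \<and> consistent c S)"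
    unfolding Greatest_def
  proof (rule arg_cong[where f = The], rule ext)
    fix c
    show "((c \<in> concepts r \<and> consistent c S) \<and> (\<forall>y. y \<in> concepts r \<and> consistent y S \<longrightarrow> y \<le> c)) =
      ((c \<in> F \<and> consistent c S) \<and> (\<forall>y. y \<in> F \<and> consistent y S \<longrightarrow> y \<le> c))"
      (is "?C \<longleftrightarrow> ?F")
    proof
      assume c: ?C
      then obtain f where f: "f \<in> F" "consistent f S" "c \<le> f"
        using assms(2) by blast
      with c assms(1) have "f = c"
        by (intro antisym) auto
      with c f assms(1) show ?F by blast
    next
      assume c: ?F
      have "y \<le> c" if "y \<in> concepts r" "consistent y S" for y
        using assms(2)[OF that] c by (meson order_trans)
      with c assms(1) show ?C by blast
    qed
  qed
  ultimately show ?thesis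
    by (simp add: O_max_def)
qed

text \<open>The prefixes of \<open>lo @ us @ hi\<close> that do not depend on the enumeration \<open>us\<close> of \<open>U\<close>.\<close>

definition committed :: "'a list \<Rightarrow> 'a set \<Rightarrow> 'a list \<Rightarrow> 'a concept set" where
  "committed lo U hi = {\<lambda>x. x \<in> set ps | ps qs. lo = ps @ qs \<and> ps \<noteq> []} \<union>
     {\<lambda>x. x \<in> set lo \<union> U \<union> set ps | ps qs. hi = ps @ qs}"

text \<open>If a prefix that depends on the order inside \<open>U\<close> is consistent with \<open>S\<close>, then so are its two
  neighbours among the committed prefixes. Hence the smallest and the largest consistent prefix
  are committed.\<close>

definition settled :: "'a sample \<Rightarrow> 'a list \<Rightarrow> 'a set \<Rightarrow> bool" where
  "settled S lo U \<longleftrightarrow> (\<forall>V. V \<noteq> {} \<longrightarrow> V \<subseteq> U \<longrightarrow> consistent (\<lambda>x. x \<in> set lo \<union> V) S \<longrightarrow>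
     lo \<noteq> [] \<and> consistent (\<lambda>x. x \<in> set lo) S \<and> consistent (\<lambda>x. x \<in> set lo \<union> U) S)"

text \<open>The second assumption keeps out the empty prefix, which is no concept but would be in
  the second family if both \<open>lo\<close> and the block were empty.\<close>

lemma committed_subset:
  assumes "distinct (lo @ us @ hi)" "lo \<noteq> [] \<or> us \<noteq> []"
  shows "committed lo (set us) hi \<subseteq> concepts (order_of (lo @ us @ hi))"
proof
  fix c assume "c \<in> committed lo (set us) hi"
  then consider ps qs where "c = (\<lambda>x. x \<in> set ps)" "lo = ps @ qs" "ps \<noteq> []"
    | ps qs where "c = (\<lambda>x. x \<in> set lo \<union> set us \<union> set ps)" "hi = ps @ qs"
    unfolding committed_def by blast
  then show "c \<in> concepts (order_of (lo @ us @ hi))"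
  proof cases
    case 1
    then have "lo @ us @ hi = ps @ (qs @ us @ hi)" by simp
    with 1 show ?thesis
      unfolding concepts_order_of[OF assms(1)] by blast
  next
    case 2
    then have "lo @ us @ hi = (lo @ us @ ps) @ qs" "c = (\<lambda>x. x \<in> set (lo @ us @ ps))"
      by (auto simp: fun_eq_iff)
    moreover have "lo @ us @ ps \<noteq> []"
      using assms(2) by auto
    ultimately show ?thesis
      unfolding concepts_order_of[OF assms(1)] by blast
  qed
qed

text \<open>The cut falls in \<open>lo\<close>, in \<open>us\<close> or in \<open>hi\<close>. For a
  cut in \<open>us\<close> only the set \<open>V\<close> of block points below it is recorded, which
  is all that \<open>settled\<close> speaks about.\<close>

lemma concepts_cases:
  assumes "distinct (lo @ us @ hi)" "c \<in> concepts (order_of (lo @ us @ hi))"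
  obtains "c \<in> committed lo (set us) hi"
    | V where "V \<noteq> {}" "V \<subseteq> set us" "c = (\<lambda>x. x \<in> set lo \<union> V)"
proof -
  obtain ps qs where c: "c = (\<lambda>x. x \<in> set ps)" "lo @ us @ hi = ps @ qs" "ps \<noteq> []"
    using assms(2) unfolding concepts_order_of[OF assms(1)] by blast
  from c(2) consider vs where "lo = ps @ vs"
    | vs where "ps = lo @ vs" "us @ hi = vs @ qs"
    by (auto simp: append_eq_append_conv2)
  then show ?thesis
  proof cases
    case 1
    then show ?thesis
      using c that(1) unfolding committed_def by blast
  next
    case 2
    from 2(2) consider ws where "us = vs @ ws" | ws where "vs = us @ ws" "hi = ws @ qs"
      by (auto simp: append_eq_append_conv2)
    then show ?thesis
    proof cases
      case 1
      show ?thesis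
      \<comment> \<open>A cut at the border between \<open>lo\<close> and \<open>us\<close> gives
        \<open>lo\<close> itself, which is committed because \<open>ps\<close> is nonempty.\<close>
      proof (cases "vs = []")
        case True
        then have "lo = ps @ []" using 2 by simp
        then show ?thesis
          using c that(1) unfolding committed_def by blast
      next
        case False
        then show ?thesis
          using that(2)[of "set vs"] 1 2 c(1) by auto
      qed
    next
      case w: 2
      then have "c = (\<lambda>x. x \<in> set lo \<union> set us \<union> set ws)"
        using c(1) 2(1) by (auto simp: fun_eq_iff)
      then show ?thesis
        using w that(1) unfolding committed_def by blast
    qed
  qed
qed

text \<open>The family \<open>committed lo U hi\<close> is the same for every enumeration
  \<open>us\<close> of \<open>U\<close>, and \<open>settled\<close> provides consistent members of
  it on both sides of every consistent concept. So it determines both extremal concepts.\<close>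

lemma settled_answer:
  assumes "selection_rule R" "settled S lo U" "lo \<noteq> [] \<or> U \<noteq> {}"
  obtains a where "\<And>us. distinct (lo @ us @ hi) \<Longrightarrow> set us = U \<Longrightarrow> R S (order_of (lo @ us @ hi)) = a"
proof -
  let ?F = "committed lo U hi"
  have F: "?F \<subseteq> concepts (order_of (lo @ us @ hi))"
    if "distinct (lo @ us @ hi)" "set us = U" for us
    using committed_subset[OF that(1)] that(2) assms(3) by auto
  have lo: "(\<lambda>x. x \<in> set lo) \<in> ?F" if "lo \<noteq> []"
    using that append_Nil2[of lo, symmetric] unfolding committed_def by blast
  have "(\<lambda>x. x \<in> set lo \<union> U \<union> set []) \<in> ?F"
    using append_Nil[of hi, symmetric] unfolding committed_def by blast
  then have loU: "(\<lambda>x. x \<in> set lo \<union> U) \<in> ?F"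
    by simp
  have below: "\<exists>f \<in> ?F. consistent f S \<and> f \<le> c" and above: "\<exists>f \<in> ?F. consistent f S \<and> c \<le> f"
    if us: "distinct (lo @ us @ hi)" "set us = U"
      and c: "c \<in> concepts (order_of (lo @ us @ hi))" "consistent c S" for us c
  proof -
    from us(1) c(1) have "(\<exists>f \<in> ?F. consistent f S \<and> f \<le> c) \<and> (\<exists>f \<in> ?F. consistent f S \<and> c \<le> f)"
    proof (cases rule: concepts_cases)
      case 1
      then show ?thesis using us(2) c(2) by auto
    next
      case (2 V)
      then have "lo \<noteq> []" "consistent (\<lambda>x. x \<in> set lo) S" "consistent (\<lambda>x. x \<in> set lo \<union> U) S"
        using assms(2) us(2) c(2) unfolding settled_def by blast+
      moreover have "(\<lambda>x. x \<in> set lo) \<le> c" "c \<le> (\<lambda>x. x \<in> set lo \<union> U)"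
        using 2 us(2) by (auto simp: le_fun_def)
      ultimately show ?thesis
        using lo loU by blast
    qed
    then show "\<exists>f \<in> ?F. consistent f S \<and> f \<le> c" "\<exists>f \<in> ?F. consistent f S \<and> c \<le> f"
      by auto
  qed
  \<comment> \<open>For fixed \<open>S\<close> the bit \<open>\<eta> S\<close> is fixed, so one and
    the same of the two rules applies to all orders.\<close>
  have "R S = O_min S \<or> R S = O_max S"
    using assms(1) by (auto simp: selection_rule_def R_eta_def fun_eq_iff)
  then show thesis
  proof
    assume "R S = O_min S"
    show thesis
      by (rule that, unfold \<open>R S = O_min S\<close>, rule O_min_eq_least_of_subset, erule (1) F, erule (3) below)
  next
    assume "R S = O_max S"
    show thesis
      by (rule that, unfold \<open>R S = O_max S\<close>, rule O_max_eq_greatest_of_subset, erule (1) F, erule (3) above)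
  qed
qed

section \<open>States of the adversary and the pairs they leave open\<close>

text \<open>The pairs of order and target still open to the adversary. In a
  \<open>block_partition\<close> the last two conjuncts put \<open>z\<close> into \<open>U\<close>
  or at the end of \<open>lo\<close>, so that \<open>lo\<close> is labelled 1 and \<open>hi\<close>
  is labelled 0.\<close>

definition compatible :: "'a list \<Rightarrow> 'a set \<Rightarrow> 'a list \<Rightarrow> 'a rel \<Rightarrow> 'a \<Rightarrow> bool" where
  "compatible lo U hi r z \<longleftrightarrow> (\<exists>us. distinct us \<and> set us = U \<and> r = order_of (lo @ us @ hi) \<and>
     z \<in> set (lo @ us) \<and> (\<forall>x \<in> set lo. (x, z) \<in> r))"

text \<open>The condition \<open>lo \<noteq> [] \<or> U \<noteq> {}\<close> leaves room for a target
  outside \<open>hi\<close>. Under E the sentinel is committed from the start and heads every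
  enumeration.\<close>

definition block_partition :: "'a convention \<Rightarrow> 'a list \<Rightarrow> 'a list \<Rightarrow> 'a set \<Rightarrow> 'a list \<Rightarrow> bool" where
  "block_partition conv xs lo U hi \<longleftrightarrow> finite U \<and> distinct (lo @ hi) \<and> U \<inter> set (lo @ hi) = {} \<and>
     set lo \<union> U \<union> set hi = points conv xs \<and> (lo \<noteq> [] \<or> U \<noteq> {}) \<and>
     (case conv of Conv_E s \<Rightarrow> lo \<noteq> [] \<and> hd lo = s | Conv_N \<Rightarrow> True)"

lemma concept_compatible:
  assumes "block_partition conv xs lo U hi" "compatible lo U hi r z" "x \<in> set lo \<union> set hi"
  shows "concept r z x \<longleftrightarrow> x \<in> set lo"
proof -
  obtain us where us: "set us = U" "r = order_of ((lo @ us) @ hi)"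
      "z \<in> set (lo @ us)" "\<forall>x \<in> set lo. (x, z) \<in> r"
    using assms(2) unfolding compatible_def by auto
  show ?thesis
  proof (cases "x \<in> set lo")
    case True
    with us show ?thesis by (simp add: concept_def)
  next
    case False
    with assms(3) have "x \<in> set hi" by simp
    with assms(1) us(1,3) have "x \<notin> set (lo @ us)" "z \<notin> set hi"
      unfolding block_partition_def by auto
    then have "(x, z) \<notin> r"
      using order_of_subset[of "lo @ us"] order_of_subset[of hi]
      unfolding us(2) order_of_append[of "lo @ us"] by auto
    with False show ?thesis by (simp add: concept_def)
  qed
qed

lemma compatible_admissible:
  assumes "block_partition conv xs lo U hi" "compatible lo U hi r z"
  shows "admissible conv xs r" "z \<in> points conv xs"
proof -
  obtain us where us: "distinct us" "set us = U" "r = order_of (lo @ us @ hi)" "z \<in> set (lo @ us)"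
    using assms(2) unfolding compatible_def by auto
  have set: "set (lo @ us @ hi) = points conv xs"
    using us(2) assms(1) unfolding block_partition_def by auto
  then show "z \<in> points conv xs"
    using us(4) by auto
  have "distinct (lo @ us @ hi)"
    using assms(1) us unfolding block_partition_def by auto
  then have "linear_order_on (points conv xs) r"
    using linear_order_order_of us(3) set by metis
  moreover have "(s, x) \<in> r" if "conv = Conv_E s" "x \<in> points conv xs" for s x
  proof -
    obtain lo' where "lo = s # lo'"
      using assms(1) \<open>conv = _\<close> unfolding block_partition_def by (cases lo) auto
    then show ?thesis
      using that(2) unfolding set[symmetric] us(3) by auto
  qed
  ultimately show "admissible conv xs r"
    unfolding admissible_def by (simp split: convention.split)
qed

text \<open>For any enumeration \<open>us\<close> of \<open>U\<close> the last entry of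
  \<open>lo @ us\<close> serves as target, since it lies above all of \<open>lo\<close>.\<close>

lemma compatible_exists:
  assumes "block_partition conv xs lo U hi"
  shows "\<exists>r z. compatible lo U hi r z"
proof -
  obtain us where us: "set us = U" "distinct us"
    using assms finite_distinct_list[of U] unfolding block_partition_def by auto
  have ne: "lo @ us \<noteq> []"
    using assms us unfolding block_partition_def by auto
  then obtain as z where snoc: "lo @ us = as @ [z]"
    by (cases "lo @ us" rule: rev_cases) blast+
  then have eq: "lo @ us @ hi = as @ z # hi"
    by (metis append.assoc append_Cons append_Nil)
  have "distinct (lo @ us @ hi)"
    using assms us unfolding block_partition_def by auto
  then have "concept (order_of (lo @ us @ hi)) z = (\<lambda>x. x \<in> set (lo @ us))"
    unfolding eq snoc by (rule concept_order_of)
  then have "\<forall>x \<in> set lo. (x, z) \<in> order_of (lo @ us @ hi)"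
    by (simp add: concept_def fun_eq_iff)
  moreover have "z \<in> set (lo @ us)"
    unfolding snoc by simp
  ultimately show ?thesis
    unfolding compatible_def using us by (intro exI conjI) auto
qed

section \<open>Moving a point out of the block\<close>

text \<open>A legal move of the adversary. The open pairs only get fewer, so a history common to all
  of them stays common; points outside \<open>U\<close> keep their side; at most one point leaves
  the block.\<close>

definition refines :: "'a convention \<Rightarrow> 'a list \<Rightarrow> 'a list \<Rightarrow> 'a set \<Rightarrow> 'a list \<Rightarrow>
    'a list \<Rightarrow> 'a set \<Rightarrow> 'a list \<Rightarrow> bool" where
  "refines conv xs lo U hi lo' U' hi' \<longleftrightarrow> block_partition conv xs lo' U' hi' \<and>
     (\<forall>r z. compatible lo' U' hi' r z \<longrightarrow> compatible lo U hi r z) \<and>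
     set lo \<subseteq> set lo' \<and> set lo' \<subseteq> set lo \<union> U \<and> U' \<subseteq> U \<and> card U \<le> Suc (card U')"

lemma refines_refl: "block_partition conv xs lo U hi \<Longrightarrow> refines conv xs lo U hi lo U hi"
  by (simp add: refines_def)

text \<open>If \<open>us\<close> enumerates \<open>U - {u}\<close>, then \<open>u # us\<close>
  enumerates \<open>U\<close> and gives the same order.\<close>

lemma refines_bottom:
  assumes "block_partition conv xs lo U hi" "u \<in> U"
  shows "refines conv xs lo U hi (lo @ [u]) (U - {u}) hi"
proof -
  have "compatible lo U hi r z" if "compatible (lo @ [u]) (U - {u}) hi r z" for r z
  proof -
    obtain us where us: "distinct us" "set us = U - {u}" "r = order_of ((lo @ [u]) @ us @ hi)"
        "z \<in> set ((lo @ [u]) @ us)" "\<forall>x \<in> set (lo @ [u]). (x, z) \<in> r"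
      using \<open>compatible (lo @ [u]) _ _ _ _\<close> unfolding compatible_def by blast
    then have "distinct (u # us)" "set (u # us) = U" "r = order_of (lo @ (u # us) @ hi)"
        "z \<in> set (lo @ (u # us))" "\<forall>x \<in> set lo. (x, z) \<in> r"
      using assms(2) by auto
    then show ?thesis
      unfolding compatible_def by blast
  qed
  moreover have "block_partition conv xs (lo @ [u]) (U - {u}) hi"
    using assms unfolding block_partition_def by (auto split: convention.splits)
  ultimately show ?thesis
    unfolding refines_def using assms(2) by (auto simp: card_Diff_singleton_if)
qed

text \<open>Here \<open>us @ [u]\<close> is the enumeration of \<open>U\<close>. The last assumption
  ensures that a possible target remains once \<open>u\<close> is labelled 0.\<close>

lemma refines_top:
  assumes "block_partition conv xs lo U hi" "u \<in> U" "lo \<noteq> [] \<or> 2 \<le> card U"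
  shows "refines conv xs lo U hi lo (U - {u}) (u # hi)"
proof -
  have "compatible lo U hi r z" if "compatible lo (U - {u}) (u # hi) r z" for r z
  proof -
    obtain us where us: "distinct us" "set us = U - {u}" "r = order_of (lo @ us @ u # hi)"
        "z \<in> set (lo @ us)" "\<forall>x \<in> set lo. (x, z) \<in> r"
      using \<open>compatible lo (U - {u}) _ _ _\<close> unfolding compatible_def by blast
    then have "distinct (us @ [u])" "set (us @ [u]) = U" "r = order_of (lo @ (us @ [u]) @ hi)"
        "z \<in> set (lo @ (us @ [u]))" "\<forall>x \<in> set lo. (x, z) \<in> r"
      using assms(2) by auto
    then show ?thesis
      unfolding compatible_def by blast
  qed
  moreover have "U - {u} \<noteq> {}" if "2 \<le> card U"
  proof
    assume "U - {u} = {}"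
    then have "card U \<le> card {u}"
      by (intro card_mono) auto
    with that show False by simp
  qed
  then have "block_partition conv xs lo (U - {u}) (u # hi)"
    using assms unfolding block_partition_def by auto
  ultimately show ?thesis
    unfolding refines_def using assms(2) by (auto simp: card_Diff_singleton_if)
qed

text \<open>A negative example in \<open>U\<close> becomes the bottom of \<open>U\<close> and a positive one the top; either way no
  prefix ending inside the remaining \<open>U\<close> is consistent. Without examples in \<open>U\<close> such a prefix is
  consistent iff its committed neighbours are, provided that \<open>lo\<close> is nonempty.\<close>

lemma refines_settled:
  assumes part: "block_partition conv xs lo U hi" and "lo \<noteq> [] \<or> 2 \<le> card U"
  obtains lo' U' hi' where "refines conv xs lo U hi lo' U' hi'" "settled S lo' U'"
proof -
  \<comment> \<open>The cases may overlap, for instance for contradictory samples; any one that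
    applies will do.\<close>
  consider v where "v \<in> U" "(v, False) \<in> S"
    | p where "p \<in> U" "(p, True) \<in> S"
    | "\<And>u b. u \<in> U \<Longrightarrow> (u, b) \<notin> S"
    by (metis (full_types))
  then show thesis
  proof cases
    case 1
    then have "settled S (lo @ [v]) (U - {v})"
      unfolding settled_def consistent_def by fastforce
    then show thesis
      using that refines_bottom[OF part 1(1)] by blast
  next
    case 2
    have "p \<notin> set lo"
      using 2(1) part unfolding block_partition_def by auto
    with 2 have "settled S lo (U - {p})"
      unfolding settled_def consistent_def by fastforce
    then show thesis
      using that refines_top[OF part 2(1) assms(2)] by blast
  next
    case 3
    have settled: "settled S ls V" if "ls \<noteq> []" "V \<subseteq> U" for ls V
      using 3 that unfolding settled_def consistent_def by blast
    show thesis
    proof (cases "lo = []")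
      case True
      \<comment> \<open>The empty set is no concept, so the block lacks a committed lower neighbour;
        placing any \<open>u\<close> at the bottom creates one.\<close>
      then obtain u where "u \<in> U"
        using part unfolding block_partition_def by auto
      then show thesis
        using that refines_bottom[OF part \<open>u \<in> U\<close>] settled[of "lo @ [u]" "U - {u}"] by auto
    next
      case False
      then show thesis
        using that refines_refl[OF part] settled by blast
    qed
  qed
qed

section \<open>Histories and the invariant of the game\<close>

lemma history_simps [simp]:
  "predictions [] = []" "labels [] = []" "queries [] = 0"
  "predictions (h @ [Answer S a]) = predictions h"
  "predictions (h @ [Prediction b]) = predictions h @ [b]"
  "predictions (h @ [Label b]) = predictions h"
  "labels (h @ [Answer S a]) = labels h"
  "labels (h @ [Prediction b]) = labels h"
  "labels (h @ [Label b]) = labels h @ [b]"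
  "queries (h @ [Answer S a]) = Suc (queries h)"
  "queries (h @ [Prediction b]) = queries h"
  "queries (h @ [Label b]) = queries h"
  by (auto simp: predictions_def labels_def queries_def)

text \<open>Used to bound calls from below: a long history with few predictions and labels contains
  many calls.\<close>

lemma length_history: "length h = length (predictions h) + length (labels h) + queries h"
proof (induction h rule: rev_induct)
  case (snoc e h)
  then show ?case by (cases e) simp_all
qed simp

lemma run_0 [simp]: "run R r z xs A 0 = []"
  by (simp add: run_def)

lemma run_Suc [simp]: "run R r z xs A (Suc n) = step R r z xs A (run R r z xs A n)"
  by (simp add: run_def)

text \<open>Unlike \<^const>\<open>mistakes\<close>, this includes a prediction whose label is still due.\<close>

definition forced :: "'a list \<Rightarrow> 'a list \<Rightarrow> bool list \<Rightarrow> nat" where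
  "forced xs lo bs = card {t. t < length bs \<and> bs ! t \<noteq> (xs ! t \<in> set lo)}"

lemma forced_cong:
  assumes "\<And>t. t < length bs \<Longrightarrow> xs ! t \<in> set lo \<longleftrightarrow> xs ! t \<in> set lo'"
  shows "forced xs lo bs = forced xs lo' bs"
  using assms unfolding forced_def by (metis (no_types, lifting))

lemma forced_snoc:
  "forced xs lo (bs @ [b]) =
    forced xs lo bs + (if b \<noteq> (xs ! length bs \<in> set lo) then 1 else 0)"
proof -
  let ?P = "\<lambda>t. t < length bs \<and> bs ! t \<noteq> (xs ! t \<in> set lo)"
  have "{t. t < length (bs @ [b]) \<and> (bs @ [b]) ! t \<noteq> (xs ! t \<in> set lo)} =
      {t. ?P t} \<union> (if b \<noteq> (xs ! length bs \<in> set lo) then {length bs} else {})"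
    by (auto simp: nth_append less_Suc_eq)
  then show ?thesis
    unfolding forced_def by (auto simp: card_insert_if)
qed

text \<open>Under convention N the target must be nonempty, so the last free point may have to be placed
  at the bottom for free. This can happen only while \<open>lo\<close> is empty, and \<open>eps\<close> pays for it.\<close>

definition invariant :: "'a convention \<Rightarrow> 'a rule \<Rightarrow> 'a list \<Rightarrow> 'a learner \<Rightarrow> nat \<Rightarrow> 'a history \<Rightarrow>
    'a list \<Rightarrow> 'a set \<Rightarrow> 'a list \<Rightarrow> bool" where
  "invariant conv R xs A n h lo U hi \<longleftrightarrow> block_partition conv xs lo U hi \<and>
     (\<forall>r z. compatible lo U hi r z \<longrightarrow> run R r z xs A n = h) \<and>
     length (labels h) \<le> length (predictions h) \<and> length (predictions h) \<le> length xs \<and>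
     (\<forall>t < length (predictions h). xs ! t \<notin> U) \<and>
     (\<forall>t < length (labels h). labels h ! t = (xs ! t \<in> set lo)) \<and>
     (length h = n \<or> length (labels h) = length xs) \<and>
     length xs \<le> card U + queries h + forced xs lo (predictions h) + (if lo = [] then 0 else eps conv)"

text \<open>All instances are free at the start, so by distinctness \<open>card U\<close> alone pays
  for \<open>length xs\<close>; the sentinel, if any, is already in \<open>lo\<close>.\<close>

lemma invariant_init:
  assumes "valid_seq conv xs" "xs \<noteq> []"
  shows "\<exists>h lo U hi. invariant conv R xs A 0 h lo U hi"
proof (cases conv)
  case (Conv_E s)
  then have "invariant conv R xs A 0 [] [s] (set xs) []"
    using assms unfolding invariant_def block_partition_def by (simp add: distinct_card)
  then show ?thesis by blast
next
  case Conv_N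
  then have "invariant conv R xs A 0 [] [] (set xs) []"
    using assms unfolding invariant_def block_partition_def by (simp add: distinct_card)
  then show ?thesis by blast
qed

text \<open>What survives a move. The cost bound loses one unit, to be recovered from a call or a
  mistake.\<close>

lemma refines_invariant:
  assumes "invariant conv R xs A n h lo U hi" "refines conv xs lo U hi lo' U' hi'"
  shows "\<forall>r z. compatible lo' U' hi' r z \<longrightarrow> run R r z xs A n = h"
    and "\<forall>t < length (predictions h). xs ! t \<notin> U'"
    and "\<forall>t < length (labels h). labels h ! t = (xs ! t \<in> set lo')"
    and "forced xs lo' (predictions h) = forced xs lo (predictions h)"
    and "length xs \<le> Suc (card U') + queries h + forced xs lo (predictions h) +
      (if lo' = [] then 0 else eps conv)"
proof -
  \<comment> \<open>Instances already predicted lie outside \<open>U\<close>, and a move changes the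
    side of points of \<open>U\<close> only.\<close>
  have eq: "xs ! t \<in> set lo \<longleftrightarrow> xs ! t \<in> set lo'" if "t < length (predictions h)" for t
    using assms that unfolding refines_def invariant_def by blast
  then show "forced xs lo' (predictions h) = forced xs lo (predictions h)"
    by (intro forced_cong) auto
  show "\<forall>r z. compatible lo' U' hi' r z \<longrightarrow> run R r z xs A n = h"
    using assms unfolding refines_def invariant_def by blast
  show "\<forall>t < length (predictions h). xs ! t \<notin> U'"
    using assms unfolding refines_def invariant_def by blast
  show "\<forall>t < length (labels h). labels h ! t = (xs ! t \<in> set lo')"
    using assms eq unfolding invariant_def by auto
  have "lo = []" if "lo' = []"
    using assms(2) that unfolding refines_def by auto
  then show "length xs \<le> Suc (card U') + queries h + forced xs lo (predictions h) +
      (if lo' = [] then 0 else eps conv)"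
    using assms unfolding refines_def invariant_def by (auto split: if_splits)
qed

text \<open>Makes \<open>refines_top\<close> applicable. The exceptional state is an empty
  \<open>lo\<close> with a single free point, which occurs only under N. Placing this point at the
  bottom lowers \<open>card U\<close> by one and switches on the summand \<open>eps conv\<close>,
  which is 1.\<close>

lemma invariant_normalize:
  assumes "invariant conv R xs A n h lo U hi"
  shows "\<exists>lo U. invariant conv R xs A n h lo U hi \<and> (lo \<noteq> [] \<or> 2 \<le> card U)"
proof (cases "lo \<noteq> [] \<or> 2 \<le> card U")
  case True
  then show ?thesis using assms by blast
next
  case False
  have part: "block_partition conv xs lo U hi"
    using assms unfolding invariant_def by blast
  with False have "finite U" "U \<noteq> {}" and N: "conv = Conv_N"
    unfolding block_partition_def by (auto split: convention.splits)
  then have "0 < card U"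
    by (simp add: card_gt_0_iff)
  with False have card: "card U = 1"
    by simp
  then obtain u where u: "U = {u}"
    by (auto simp: card_1_singleton_iff)
  have ref: "refines conv xs lo U hi (lo @ [u]) (U - {u}) hi"
    using refines_bottom[OF part] u by simp
  have "invariant conv R xs A n h (lo @ [u]) (U - {u}) hi"
    using assms refines_invariant[OF assms ref] ref u N False
    unfolding invariant_def refines_def by auto
  then show ?thesis by auto
qed

text \<open>After normalization, a call pays for one point of \<open>U\<close> through
  \<open>queries\<close> and a prediction on a point of \<open>U\<close> pays through
  \<open>forced\<close>; labels and idle steps move nothing.\<close>

lemma invariant_step:
  assumes "selection_rule R" "invariant conv R xs A n h lo0 U0 hi"
  shows "\<exists>h lo U hi. invariant conv R xs A (Suc n) h lo U hi"
proof -
  obtain lo U where inv: "invariant conv R xs A n h lo U hi" and big: "lo \<noteq> [] \<or> 2 \<le> card U"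
    using invariant_normalize[OF assms(2)] by blast
  then have part: "block_partition conv xs lo U hi"
    unfolding invariant_def by blast
  let ?t = "length (labels h)"
  note I = inv[unfolded invariant_def]
  have points: "xs ! t \<in> set lo \<union> U \<union> set hi" if "t < length xs" for t
    using part nth_mem[OF that] unfolding block_partition_def by (cases conv) auto
  show ?thesis
  proof (cases "ask A xs h")
    case (Some S)
    obtain lo' U' hi' where ref: "refines conv xs lo U hi lo' U' hi'" and S: "settled S lo' U'"
      using refines_settled[OF part big] by blast
    have part': "block_partition conv xs lo' U' hi'"
      using ref unfolding refines_def by blast
    then obtain a where a: "R S (order_of (lo' @ us @ hi')) = a"
      if "distinct (lo' @ us @ hi')" "set us = U'" for us
      using settled_answer[OF assms(1) S] unfolding block_partition_def by metis
    have "R S r = a" if "compatible lo' U' hi' r z" for r z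
    proof -
      obtain us where us: "distinct us" "set us = U'" "r = order_of (lo' @ us @ hi')"
        using \<open>compatible lo' U' hi' r z\<close> unfolding compatible_def by blast
      then have "distinct (lo' @ us @ hi')"
        using part' unfolding block_partition_def by auto
      then show ?thesis
        using a us by blast
    qed
    then have "\<forall>r z. compatible lo' U' hi' r z \<longrightarrow> run R r z xs A (Suc n) = h @ [Answer S a]"
      using refines_invariant(1)[OF inv ref] Some by (simp add: step_def)
    then have "invariant conv R xs A (Suc n) (h @ [Answer S a]) lo' U' hi'"
      using I part' refines_invariant(2-)[OF inv ref] unfolding invariant_def by auto
    then show ?thesis by blast
  next
    case None
    consider "?t < length (predictions h)"
      | "?t = length (predictions h)" "?t < length xs"
      | "?t = length (predictions h)" "?t = length xs"
      using I by linarith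
    then show ?thesis
    proof cases
      case 1
      \<comment> \<open>This instance has already been predicted, so it is outside \<open>U\<close>
        and its label is the same for all open pairs.\<close>
      then have "xs ! ?t \<in> set lo \<union> set hi"
        using I points[of ?t] by auto
      then have "concept r z (xs ! ?t) = (xs ! ?t \<in> set lo)" if "compatible lo U hi r z" for r z
        using concept_compatible[OF part that] by simp
      then have "\<forall>r z. compatible lo U hi r z \<longrightarrow>
          run R r z xs A (Suc n) = h @ [Label (xs ! ?t \<in> set lo)]"
        using I None 1 by (simp add: step_def)
      then have "invariant conv R xs A (Suc n) (h @ [Label (xs ! ?t \<in> set lo)]) lo U hi"
        using I 1 unfolding invariant_def by (auto simp: nth_append less_Suc_eq)
      then show ?thesis by blast
    next
      case 2
      let ?b = "predict A xs h"
      \<comment> \<open>An instance in \<open>U\<close> goes to \<open>hi\<close> if 1 is predicted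
        and to \<open>lo\<close> if 0 is predicted, which makes the prediction wrong. Any other
        instance leaves the partition as it is.\<close>
      obtain lo' U' hi' where ref: "refines conv xs lo U hi lo' U' hi'"
        and U': "xs ! ?t \<notin> U'" and mistake: "xs ! ?t \<in> U \<Longrightarrow> ?b \<noteq> (xs ! ?t \<in> set lo')"
        and stay: "xs ! ?t \<notin> U \<Longrightarrow> lo' = lo \<and> U' = U"
      proof (cases "xs ! ?t \<in> U")
        case False
        then show thesis
          using that refines_refl[OF part] by blast
      next
        case True
        then have "xs ! ?t \<notin> set lo"
          using part unfolding block_partition_def by auto
        then show thesis
          using that[OF refines_top[OF part True big]] that[OF refines_bottom[OF part True]] True
          by (cases ?b) auto
      qed
      have "\<forall>r z. compatible lo' U' hi' r z \<longrightarrow> run R r z xs A (Suc n) = h @ [Prediction ?b]"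
        using refines_invariant(1)[OF inv ref] None 2 by (simp add: step_def Let_def)
      moreover have "length xs \<le> card U' + queries h + forced xs lo' (predictions h @ [?b]) +
          (if lo' = [] then 0 else eps conv)"
        using refines_invariant(4-)[OF inv ref] mistake stay I 2(1)
        by (cases "xs ! ?t \<in> U") (auto simp: forced_snoc)
      ultimately have "invariant conv R xs A (Suc n) (h @ [Prediction ?b]) lo' U' hi'"
        using I ref refines_invariant(2,3)[OF inv ref] U' 2
        unfolding invariant_def refines_def by (auto simp: less_Suc_eq)
      then show ?thesis by blast
    next
      case 3
      then have "\<forall>r z. compatible lo U hi r z \<longrightarrow> run R r z xs A (Suc n) = h"
        using I None by (simp add: step_def)
      then have "invariant conv R xs A (Suc n) h lo U hi"
        using I 3 unfolding invariant_def by simp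
      then show ?thesis by blast
    qed
  qed
qed

section \<open>The lower bound\<close>

lemma run_le_M: "enat (mistakes (run R r z xs A n)) \<le> M R r z xs A"
  unfolding M_def by (rule SUP_upper) simp

lemma run_le_Q: "enat (queries (run R r z xs A n)) \<le> Q R r z xs A"
  unfolding Q_def by (rule SUP_upper) simp

lemma adversary:
  assumes "selection_rule R" "valid_seq conv xs" "xs \<noteq> []"
  shows "\<exists>r z. admissible conv xs r \<and> z \<in> points conv xs \<and>
    enat (length xs - eps conv) \<le> M R r z xs A + Q R r z xs A"
proof -
  have "\<exists>h lo U hi. invariant conv R xs A n h lo U hi" for n
  proof (induction n)
    case 0
    then show ?case using invariant_init assms by blast
  next
    case (Suc n)
    then show ?case using invariant_step assms by blast
  qed
  \<comment> \<open>This many steps suffice: if labels are still missing, then fewer than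
    \<open>2 * length xs\<close> of the events are predictions and labels, so more than
    \<open>length xs\<close> are calls.\<close>
  then obtain h lo U hi where inv: "invariant conv R xs A (3 * length xs) h lo U hi"
    by blast
  then have part: "block_partition conv xs lo U hi"
    and run: "\<And>r z. compatible lo U hi r z \<Longrightarrow> run R r z xs A (3 * length xs) = h"
    and len: "length (labels h) \<le> length (predictions h)" "length (predictions h) \<le> length xs"
    and placed: "\<And>t. t < length (predictions h) \<Longrightarrow> xs ! t \<notin> U"
    and labels: "\<And>t. t < length (labels h) \<Longrightarrow> labels h ! t = (xs ! t \<in> set lo)"
    and "length h = 3 * length xs \<or> length (labels h) = length xs"
    and cost: "length xs \<le> card U + queries h + forced xs lo (predictions h) +
      (if lo = [] then 0 else eps conv)"
    unfolding invariant_def by blast+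
  obtain r z where rz: "compatible lo U hi r z"
    using compatible_exists part by blast
  have "length xs - eps conv \<le> mistakes h + queries h"
  proof (cases "length (labels h) = length xs")
    case True
    with len have len': "length (predictions h) = length xs"
      by simp
    with placed have disj: "set xs \<inter> U = {}"
      by (auto simp: in_set_conv_nth)
    \<comment> \<open>All instances have left the block and the sentinel, if any, is in
      \<open>lo\<close>; hence calls and mistakes carry the bound, up to
      \<open>eps conv\<close>.\<close>
    have "U = {}"
    proof (rule equals0I)
      fix u assume "u \<in> U"
      then have "u \<in> points conv xs" "u \<notin> set lo" "u \<notin> set xs"
        using part disj unfolding block_partition_def by auto
      moreover have "s \<in> set lo" if "conv = Conv_E s" for s
        using part hd_in_set[of lo] that unfolding block_partition_def by auto
      ultimately show False
        by (cases conv) auto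
    qed
    \<comment> \<open>All labels are known now, so every forced mistake has become an actual
      one.\<close>
    moreover have "mistakes h = forced xs lo (predictions h)"
      unfolding mistakes_def forced_def using labels len' True
      by (metis (mono_tags, lifting))
    ultimately show ?thesis
      using cost by (simp split: if_splits)
  next
    case False
    with len have "length (labels h) < length xs"
      by simp
    moreover have "length h = 3 * length xs"
      using False \<open>length h = _ \<or> _\<close> by blast
    ultimately show ?thesis
      using len length_history[of h] by linarith
  qed
  also have "mistakes h = mistakes (run R r z xs A (3 * length xs))"
    using run[OF rz] by simp
  also have "queries h = queries (run R r z xs A (3 * length xs))"
    using run[OF rz] by simp
  finally have "enat (length xs - eps conv) \<le>
      enat (mistakes (run R r z xs A (3 * length xs))) + enat (queries (run R r z xs A (3 * length xs)))"
    by simp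
  also have "\<dots> \<le> M R r z xs A + Q R r z xs A"
    by (intro add_mono run_le_M run_le_Q)
  finally show ?thesis
    using compatible_admissible[OF part rz] by blast
qed

section \<open>The upper bound, by learners without calls\<close>

lemma no_calls_in_learners: "no_calls f \<in> learners conv"
  by (simp add: learners_def no_calls_def)

lemma run_no_calls:
  fixes R :: "'a rule" and r :: "'a rel" and z :: 'a and xs :: "'a list"
    and f :: "'a list \<Rightarrow> 'a history \<Rightarrow> bool"
  defines "h \<equiv> run R r z xs (no_calls f)"
  shows "queries (h n) = 0"
    and "length (labels (h n)) \<le> length (predictions (h n))"
    and "length (predictions (h n)) \<le> length xs"
    and "t < length (labels (h n)) \<Longrightarrow> labels (h n) ! t = concept r z (xs ! t)"
    and "b \<in> set (predictions (h n)) \<Longrightarrow> \<exists>h'. b = f xs h'"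
proof -
  \<comment> \<open>A joint induction, since bounding the number of predictions uses the bound on
    the number of labels.\<close>
  have "queries (h n) = 0 \<and> length (labels (h n)) \<le> length (predictions (h n)) \<and>
      length (predictions (h n)) \<le> length xs \<and>
      (\<forall>t < length (labels (h n)). labels (h n) ! t = concept r z (xs ! t)) \<and>
      (\<forall>b \<in> set (predictions (h n)). \<exists>h'. b = f xs h')"
    unfolding h_def
    by (induction n) (auto simp: step_def no_calls_def Let_def nth_append less_Suc_eq)
  then show "queries (h n) = 0"
    and "length (labels (h n)) \<le> length (predictions (h n))"
    and "length (predictions (h n)) \<le> length xs"
    and "t < length (labels (h n)) \<Longrightarrow> labels (h n) ! t = concept r z (xs ! t)"
    and "b \<in> set (predictions (h n)) \<Longrightarrow> \<exists>h'. b = f xs h'"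
    by blast+
qed

lemma worst_case_no_calls_le:
  assumes "\<And>r z n. z \<in> points conv xs \<Longrightarrow> admissible conv xs r \<Longrightarrow>
    mistakes (run R r z xs (no_calls f) n) \<le> k"
  shows "worst_case conv R xs (no_calls f) \<le> enat k"
proof -
  have "M R r z xs (no_calls f) + Q R r z xs (no_calls f) \<le> enat k"
    if "z \<in> points conv xs" "admissible conv xs r" for r z
  proof -
    have "Q R r z xs (no_calls f) = 0"
      unfolding Q_def by (simp add: run_no_calls(1) zero_enat_def[symmetric])
    moreover have "M R r z xs (no_calls f) \<le> enat k"
      unfolding M_def using assms that by (auto intro: SUP_least)
    ultimately show ?thesis by simp
  qed
  then show ?thesis
    unfolding worst_case_def by (auto intro!: SUP_least)
qed

lemma mistakes_no_calls_le: "mistakes (run R r z xs (no_calls f) n) \<le> length xs"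
proof -
  have "mistakes (run R r z xs (no_calls f) n) \<le> card {..<length xs}"
    unfolding mistakes_def using run_no_calls(2,3)[of R r z xs f n]
    by (intro card_mono) auto
  then show ?thesis by simp
qed

text \<open>In the round of the target itself the label is 1 by reflexivity, so at least this round
  is never a mistake.\<close>

lemma mistakes_always_True_le:
  assumes "admissible Conv_N xs r" "z \<in> set xs"
  shows "mistakes (run R r z xs (no_calls (\<lambda>xs h. True)) n) \<le> length xs - 1"
proof -
  let ?h = "run R r z xs (no_calls (\<lambda>xs h. True)) n"
  obtain k where k: "k < length xs" "xs ! k = z"
    using assms(2) by (auto simp: in_set_conv_nth)
  have "concept r z z"
    using assms
    by (auto simp: concept_def admissible_def linear_order_on_def partial_order_on_def
        preorder_on_def refl_on_def)
  moreover have "predictions ?h ! t" if "t < length (labels ?h)" for t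
  proof -
    have "predictions ?h ! t \<in> set (predictions ?h)"
      using that run_no_calls(2)[of R r z xs "\<lambda>xs h. True" n] by (intro nth_mem) simp
    then show ?thesis
      using run_no_calls(5)[of _ R r z xs "\<lambda>xs h. True" n] by blast
  qed
  ultimately have "{t. t < length (labels ?h) \<and> predictions ?h ! t \<noteq> labels ?h ! t} \<subseteq>
      {..<length xs} - {k}"
    using run_no_calls(2,3)[of R r z xs "\<lambda>xs h. True" n]
      run_no_calls(4)[of _ R r z xs "\<lambda>xs h. True" n] k(2)
    by (auto dest: order_less_le_trans)
  then have "mistakes ?h \<le> card ({..<length xs} - {k})"
    unfolding mistakes_def by (intro card_mono) auto
  then show ?thesis
    using k(1) by simp
qed

theorem theorem3p1:
  fixes conv :: "'a convention" and R :: "'a rule" and T :: nat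
  assumes "T \<ge> 1" and "selection_rule R"
  shows
    "(\<forall>A \<in> learners conv. \<forall>xs. length xs = T \<and> valid_seq conv xs \<longrightarrow>
        (\<exists>r z. admissible conv xs r \<and> z \<in> points conv xs \<and>
           M R r z xs A + Q R r z xs A \<ge> enat (T - eps conv))) \<and>
     (\<forall>xs. length xs = T \<and> valid_seq conv xs \<longrightarrow>
        (INF A \<in> learners conv. worst_case conv R xs A) = enat (T - eps conv) \<and>
        (case conv of
           Conv_E s \<Rightarrow> \<forall>f. worst_case conv R xs (no_calls f) = enat (T - eps conv)
         | Conv_N \<Rightarrow> worst_case conv R xs (no_calls (\<lambda>xs h. True)) = enat (T - eps conv)))"
proof (intro conjI ballI allI impI)
  fix A :: "'a learner" and xs assume "length xs = T \<and> valid_seq conv xs"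
  then have "valid_seq conv xs" "xs \<noteq> []" "length xs = T"
    using assms(1) by auto
  then show "\<exists>r z. admissible conv xs r \<and> z \<in> points conv xs \<and>
      M R r z xs A + Q R r z xs A \<ge> enat (T - eps conv)"
    using adversary[OF assms(2)] by blast
next
  fix xs :: "'a list" assume xs: "length xs = T \<and> valid_seq conv xs"
  then have ne: "xs \<noteq> []"
    using assms(1) by auto
  have lower: "enat (T - eps conv) \<le> worst_case conv R xs A" for A
  proof -
    obtain r z where rz: "admissible conv xs r" "z \<in> points conv xs"
        "enat (T - eps conv) \<le> M R r z xs A + Q R r z xs A"
      using adversary[OF assms(2), of conv xs A] xs ne by blast
    have "M R r z xs A + Q R r z xs A \<le> worst_case conv R xs A"
      unfolding worst_case_def using rz(1,2) by (intro SUP_upper2[of "(r, z)"]) auto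
    with rz(3) show ?thesis by (rule order_trans)
  qed
  \<comment> \<open>Under E there are at most \<open>T\<close> mistakes for any \<open>f\<close>;
    under N always predicting 1 saves one round.\<close>
  have upper: "worst_case conv R xs (no_calls f) \<le> enat (T - eps conv)"
    if "conv = Conv_N \<longrightarrow> f = (\<lambda>xs h. True)" for f
  proof (rule worst_case_no_calls_le)
    fix r z n assume "z \<in> points conv xs" "admissible conv xs r"
    then show "mistakes (run R r z xs (no_calls f) n) \<le> T - eps conv"
      using that xs mistakes_no_calls_le[of R r z xs f n] mistakes_always_True_le[of xs r z R n]
      by (cases conv) auto
  qed
  show "(case conv of
      Conv_E s \<Rightarrow> \<forall>f. worst_case conv R xs (no_calls f) = enat (T - eps conv)
    | Conv_N \<Rightarrow> worst_case conv R xs (no_calls (\<lambda>xs h. True)) = enat (T - eps conv))"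
    using upper lower by (auto intro!: antisym split: convention.split)
  \<comment> \<open>Always predicting 1 attains the infimum under both conventions.\<close>
  have "(INF A \<in> learners conv. worst_case conv R xs A) \<le>
      worst_case conv R xs (no_calls (\<lambda>xs h. True))"
    by (intro INF_lower no_calls_in_learners)
  also have "\<dots> \<le> enat (T - eps conv)"
    by (intro upper) simp
  finally show "(INF A \<in> learners conv. worst_case conv R xs A) = enat (T - eps conv)"
    using lower by (intro antisym INF_greatest)
qed

end
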